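(* Let $h\in L^2(\mathbb{R})$ be the Gaussian $h(x):=e^{-x^2}$ and for $f\in L^2(\mathbb{R})$, $t\in\mathbb{R}$ define $$X_t(f):=f+th\qquad\text{and}\qquad Y_t(f)(x):=f(x+t).$$ Then the reachable set $$R(X,Y):=\left\{Y_{s_n}X_{t_n}Y_{s_{n-1}}X_{t_{n-1}}\cdots Y_{s_1}X_{t_1}(0)\in L^2(\mathbb{R}) : s_i,t_i\in\mathbb{R},\ n\in\mathbb{N}\right\}$$ is dense in $L^2(\mathbb{R})$.
   Context: $L^2(\mathbb{R})$ is the real Hilbert space of square-integrable real functions on $\mathbb{R}$; $0\in L^2(\mathbb{R})$ is the constant zero function; juxtaposition of maps denotes composition. *)

theory Defs
  imports "HOL-Probability.Probability"
begin

definition square_integrable :: "(real \<Rightarrow> real) \<Rightarrow> bool" where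
  "square_integrable f \<longleftrightarrow>
     f \<in> borel_measurable lebesgue \<and> integrable lebesgue (\<lambda>x. (f x)\<^sup>2)"

lemma square_integrable_mult:
  assumes "square_integrable f" "square_integrable g"
  shows "integrable lebesgue (\<lambda>x. f x * g x)"
proof (rule Bochner_Integration.integrable_bound)
  show "integrable lebesgue (\<lambda>x. (f x)\<^sup>2 + (g x)\<^sup>2)"
    using assms unfolding square_integrable_def by auto
  show "(\<lambda>x. f x * g x) \<in> borel_measurable lebesgue"
    using assms unfolding square_integrable_def by auto
  have "\<bar>a * b\<bar> \<le> a\<^sup>2 + b\<^sup>2" for a b :: real
  proof -
    have "2 * \<bar>a * b\<bar> \<le> a\<^sup>2 + b\<^sup>2"
      using sum_squares_bound[of "\<bar>a\<bar>" "\<bar>b\<bar>"] by (simp add: abs_mult mult.assoc)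
    then show ?thesis using abs_ge_zero[of "a * b"] by linarith
  qed
  then show "AE x in lebesgue. norm (f x * g x) \<le> norm ((f x)\<^sup>2 + (g x)\<^sup>2)"
    by (simp add: sum_power2_ge_zero)
qed

lemma square_integrable_add:
  assumes "square_integrable f" "square_integrable g"
  shows "square_integrable (\<lambda>x. f x + g x)"
proof -
  have "integrable lebesgue (\<lambda>x. (f x)\<^sup>2 + (g x)\<^sup>2 + 2 * (f x * g x))"
    using assms square_integrable_mult[OF assms] unfolding square_integrable_def by auto
  then show ?thesis
    using assms unfolding square_integrable_def by (auto simp: power2_sum mult.assoc)
qed

lemma square_integrable_cmult:
  assumes "square_integrable f"
  shows "square_integrable (\<lambda>x. c * f x)"
  using assms unfolding square_integrable_def by (auto simp: power_mult_distrib)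

lemma square_integrable_zero: "square_integrable (\<lambda>x. 0)"
  unfolding square_integrable_def by simp

lemma lebesgue_distr_translate:
  "distr lebesgue lebesgue (\<lambda>x. x + t) = (lebesgue :: real measure)"
proof -
  have "lebesgue = density (distr lebesgue lebesgue (\<lambda>x::real. t + 1 * x)) (\<lambda>_. ennreal \<bar>1\<bar>)"
    by (rule lebesgue_real_affine) simp
  also have "\<dots> = distr lebesgue lebesgue (\<lambda>x. x + t)"
    by (simp add: density_1 add.commute)
  finally show ?thesis ..
qed

lemma measurable_translate_lebesgue:
  "(\<lambda>x::real. x + t) \<in> lebesgue \<rightarrow>\<^sub>M lebesgue"
  using lebesgue_affine_measurable[of "\<lambda>_::real. 1" t] by (simp add: add.commute)

lemma AE_translate_lebesgue:
  assumes "AE x in lebesgue. P (x::real)"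
  shows "AE x in lebesgue. P (x + t)"
  using AE_distrD[OF measurable_translate_lebesgue[of t], of P] assms
  unfolding lebesgue_distr_translate by blast

lemma square_integrable_translate:
  assumes "square_integrable f"
  shows "square_integrable (\<lambda>x. f (x + t))"
proof -
  have m: "(\<lambda>x. f (x + t)) \<in> borel_measurable lebesgue"
    using measurable_compose[OF measurable_translate_lebesgue] assms
    unfolding square_integrable_def by blast
  have "integrable (distr lebesgue lebesgue (\<lambda>x. x + t)) (\<lambda>x. (f x)\<^sup>2)"
    using assms unfolding square_integrable_def lebesgue_distr_translate by simp
  then have "integrable lebesgue (\<lambda>x. (f (x + t))\<^sup>2)"
    by (rule integrable_distr[OF measurable_translate_lebesgue])
  with m show ?thesis unfolding square_integrable_def by simp
qed

lemma square_integrable_gaussian: "square_integrable (\<lambda>x. exp (- x\<^sup>2))"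
proof -
  have "integrable lborel (\<lambda>x. sqrt (pi / 2) * normal_density 0 (1/2) x)"
    by (intro integrable_mult_right integrable_normal_density) simp
  also have "(\<lambda>x. sqrt (pi / 2) * normal_density 0 (1/2) x) = (\<lambda>x. (exp (- x\<^sup>2))\<^sup>2)"
    by (auto simp: normal_density_def power2_eq_square real_sqrt_divide real_sqrt_mult
        simp flip: exp_add)
  finally have "integrable lborel (\<lambda>x::real. (exp (- x\<^sup>2))\<^sup>2)" .
  then have "integrable lebesgue (\<lambda>x::real. (exp (- x\<^sup>2))\<^sup>2)"
    by (subst integrable_completion) auto
  moreover have "(\<lambda>x::real. exp (- x\<^sup>2)) \<in> borel_measurable lebesgue"
    by (intro measurable_completion) simp
  ultimately show ?thesis unfolding square_integrable_def by simp
qed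

definition L2_rel :: "(real \<Rightarrow> real) \<Rightarrow> (real \<Rightarrow> real) \<Rightarrow> bool" where
  "L2_rel f g \<longleftrightarrow> square_integrable f \<and> square_integrable g \<and> (AE x in lebesgue. f x = g x)"

quotient_type L2 = "real \<Rightarrow> real" / partial: L2_rel
proof (rule part_equivpI)
  show "\<exists>f. L2_rel f f"
    using square_integrable_zero unfolding L2_rel_def by auto
  show "symp L2_rel"
    unfolding L2_rel_def by (auto intro!: sympI elim: AE_mp)
  show "transp L2_rel"
    unfolding L2_rel_def by (auto intro!: transpI elim: AE_mp)
qed

instantiation L2 :: real_vector
begin

lift_definition zero_L2 :: L2 is "\<lambda>x. 0"
  by (simp add: L2_rel_def square_integrable_zero)

lift_definition plus_L2 :: "L2 \<Rightarrow> L2 \<Rightarrow> L2" is "\<lambda>f g x. f x + g x"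
  unfolding L2_rel_def by (auto intro: square_integrable_add elim: AE_mp)

lift_definition uminus_L2 :: "L2 \<Rightarrow> L2" is "\<lambda>f x. - f x"
  unfolding L2_rel_def using square_integrable_cmult[where c = "-1"] by auto

lift_definition minus_L2 :: "L2 \<Rightarrow> L2 \<Rightarrow> L2" is "\<lambda>f g x. f x - g x"
  unfolding L2_rel_def
  using square_integrable_add square_integrable_cmult[where c = "-1"]
  by (fastforce elim: AE_mp)

lift_definition scaleR_L2 :: "real \<Rightarrow> L2 \<Rightarrow> L2" is "\<lambda>c f x. c * f x"
  unfolding L2_rel_def by (auto intro: square_integrable_cmult)

instance
proof
  fix a b :: real and x y z :: L2
  show "x + y + z = x + (y + z)"
    by transfer (auto simp: L2_rel_def add.assoc intro!: square_integrable_add)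
  show "x + y = y + x"
    by transfer (auto simp: L2_rel_def add.commute intro!: square_integrable_add)
  show "0 + x = x"
    by transfer (auto simp: L2_rel_def)
  show "- x + x = 0"
    by transfer (auto simp: L2_rel_def square_integrable_zero)
  show "x - y = x + - y"
    by transfer (use square_integrable_add square_integrable_cmult[where c = "-1"] in
        \<open>fastforce simp: L2_rel_def\<close>)
  show "a *\<^sub>R (x + y) = a *\<^sub>R x + a *\<^sub>R y"
    by transfer (auto simp: L2_rel_def distrib_left
        intro!: square_integrable_add square_integrable_cmult)
  show "(a + b) *\<^sub>R x = a *\<^sub>R x + b *\<^sub>R x"
    by transfer (auto simp: L2_rel_def distrib_right
        intro!: square_integrable_add square_integrable_cmult)
  show "a *\<^sub>R b *\<^sub>R x = (a * b) *\<^sub>R x"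
    by transfer (auto simp: L2_rel_def mult.assoc intro!: square_integrable_cmult)
  show "1 *\<^sub>R x = x"
    by transfer (auto simp: L2_rel_def)
qed

end

instantiation L2 :: real_inner
begin

lift_definition inner_L2 :: "L2 \<Rightarrow> L2 \<Rightarrow> real" is "\<lambda>f g. \<integral>x. f x * g x \<partial>lebesgue"
proof (rule integral_cong_AE)
  fix f f' g g' :: "real \<Rightarrow> real"
  assume *: "L2_rel f f'" "L2_rel g g'"
  then show "(\<lambda>x. f x * g x) \<in> borel_measurable lebesgue"
    "(\<lambda>x. f' x * g' x) \<in> borel_measurable lebesgue"
    unfolding L2_rel_def square_integrable_def by auto
  show "AE x in lebesgue. f x * g x = f' x * g' x"
    using * unfolding L2_rel_def by (auto elim: AE_mp)
qed

definition norm_L2 :: "L2 \<Rightarrow> real" where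
  "norm_L2 f = sqrt (inner f f)"

definition sgn_L2 :: "L2 \<Rightarrow> L2" where
  "sgn_L2 f = f /\<^sub>R norm f"

definition dist_L2 :: "L2 \<Rightarrow> L2 \<Rightarrow> real" where
  "dist_L2 f g = norm (f - g)"

definition uniformity_L2 :: "(L2 \<times> L2) filter" where
  "uniformity_L2 = (INF e\<in>{0<..}. principal {(f, g). dist f g < e})"

definition open_L2 :: "L2 set \<Rightarrow> bool" where
  "open_L2 U \<longleftrightarrow> (\<forall>f\<in>U. \<forall>\<^sub>F (f', g) in uniformity. f' = f \<longrightarrow> g \<in> U)"

instance
proof
  fix r :: real and x y z :: L2 and U :: "L2 set"
  show "dist x y = norm (x - y)" by (simp add: dist_L2_def)
  show "sgn x = x /\<^sub>R norm x" by (simp add: sgn_L2_def)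
  show "(uniformity :: (L2 \<times> L2) filter) = (INF e\<in>{0<..}. principal {(f, g). dist f g < e})"
    by (rule uniformity_L2_def)
  show "open U \<longleftrightarrow> (\<forall>f\<in>U. \<forall>\<^sub>F (f', g) in uniformity. f' = f \<longrightarrow> g \<in> U)"
    by (rule open_L2_def)
  show "inner x y = inner y x"
    by transfer (simp add: mult.commute)
  show "inner (x + y) z = inner x z + inner y z"
    by transfer (simp add: L2_rel_def distrib_right square_integrable_mult)
  show "inner (r *\<^sub>R x) y = r * inner x y"
    by transfer (simp add: L2_rel_def mult.assoc)
  show "0 \<le> inner x x"
    by transfer simp
  show "inner x x = 0 \<longleftrightarrow> x = 0"
  proof transfer
    fix f assume "L2_rel f f"
    then have f: "square_integrable f" by (simp add: L2_rel_def)
    have "(\<integral>x. f x * f x \<partial>lebesgue) = 0 \<longleftrightarrow> (AE x in lebesgue. f x * f x = 0)"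
      by (rule integral_nonneg_eq_0_iff_AE) (use square_integrable_mult[OF f f] in auto)
    then show "(\<integral>x. f x * f x \<partial>lebesgue) = 0 \<longleftrightarrow> L2_rel f (\<lambda>x. 0)"
      using f by (simp add: L2_rel_def square_integrable_zero)
  qed
  show "norm x = sqrt (inner x x)" by (rule norm_L2_def)
qed

end

lift_definition gaussian :: L2 is "\<lambda>x. exp (- x\<^sup>2)"
  by (simp add: L2_rel_def square_integrable_gaussian)

definition flow_X :: "real \<Rightarrow> L2 \<Rightarrow> L2" where
  "flow_X t f = f + t *\<^sub>R gaussian"

lift_definition flow_Y :: "real \<Rightarrow> L2 \<Rightarrow> L2" is "\<lambda>t f x. f (x + t)"
proof -
  fix t :: real and f g
  assume "L2_rel f g"
  then show "L2_rel (\<lambda>x. f (x + t)) (\<lambda>x. g (x + t))"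
    using AE_translate_lebesgue[of "\<lambda>x. f x = g x" t]
    by (simp add: L2_rel_def square_integrable_translate)
qed

text \<open>\<open>fold g [1, ..., n]\<close> is the composition \<open>g n \<circ> ... \<circ> g 1\<close>, so the maps with index \<open>1\<close>
  act first. For \<open>n = 0\<close> the reached point is \<open>0\<close>.\<close>

definition reachable_set ::
  "(real \<Rightarrow> 'a \<Rightarrow> 'a) \<Rightarrow> (real \<Rightarrow> 'a \<Rightarrow> 'a) \<Rightarrow> 'a::zero set" where
  "reachable_set X Y =
     {fold (\<lambda>i. Y (s i) \<circ> X (t i)) [1..<Suc n] 0 | (s :: nat \<Rightarrow> real) (t :: nat \<Rightarrow> real) (n :: nat). True}"

end

theory Submission
  imports Defs "HOL-Real_Asymp.Real_Asymp"
begin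

text \<open>
  Write \<open>h(x) = exp (- x\<^sup>2)\<close>. The detour \<open>Y_a X_c Y_(-a)\<close> adds \<open>c\<close> times a translate of \<open>h\<close>, so the
  reachable set contains the linear span of all translates of \<open>h\<close>. It remains to see that the
  closure \<open>V\<close> of this span is all of \<open>L\<^sup>2\<close>. The classical argument takes a function orthogonal to
  \<open>V\<close> and uses injectivity of the Fourier transform; here every function is instead reached directly,
  by repeated dominated convergence inside \<open>V\<close>.

  Up to a constant factor the translates of \<open>h\<close> are the functions \<open>exp (- x\<^sup>2 + b x)\<close>, so \<open>V\<close>
  contains \<open>h\<close> times any combination of real exponentials. Since
  \<open>(2 - cosh (x / sqrt n)) ^ n\<close> is such a combination, tends to \<open>exp (- x\<^sup>2 / 2)\<close>, and is bounded by
  \<open>exp (x\<^sup>2 / 2)\<close>, which \<open>h\<close> absorbs, dominated convergence yields strictly narrower Gaussians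
  \<open>exp (- 3/2 x\<^sup>2 + b x)\<close> in \<open>V\<close> (\<open>approximable_narrow_gaussian\<close>).

  Equivalently, multiplication by any \<open>exp (- (x - m)\<^sup>2 / 2)\<close> maps the generators of \<open>V\<close> into \<open>V\<close>,
  and hence \<open>V\<close> into itself (\<open>multiplier_gaussian\<close>). The bounded functions which multiply \<open>V\<close> into
  \<open>V\<close> form an algebra closed under bounded pointwise limits. Such an algebra contains, with a
  nonnegative function \<open>u\<close>, the indicators of its sublevel sets (\<open>multiplier_indicator_less\<close>). The
  sublevel sets of shifted Gaussians are the complements of intervals, so the algebra contains the
  indicators of all Borel sets (\<open>multiplier_indicator_borel\<close>) and thus all simple functions.
  Finally any square-integrable Borel function \<open>g\<close> is \<open>h\<close> times \<open>g / h\<close>, and approximating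
  \<open>g / h\<close> by simple functions \<open>s\<^sub>i\<close> with \<open>\<bar>s\<^sub>i\<bar> \<le> 2 \<bar>g / h\<bar>\<close> gives \<open>g\<close> as a dominated limit of
  elements of \<open>V\<close>.
\<close>

section \<open>Square-integrable functions and their classes\<close>

lemma square_integrable_dominated:
  assumes g: "square_integrable g" and f: "f \<in> borel_measurable lebesgue"
    and le: "\<And>x. \<bar>f x\<bar> \<le> g x"
  shows "square_integrable f"
  unfolding square_integrable_def
proof
  show "integrable lebesgue (\<lambda>x. (f x)\<^sup>2)"
  proof (rule Bochner_Integration.integrable_bound)
    show "integrable lebesgue (\<lambda>x. (g x)\<^sup>2)"
      using g by (simp add: square_integrable_def)
    show "(\<lambda>x. (f x)\<^sup>2) \<in> borel_measurable lebesgue"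
      using f by (rule borel_measurable_power)
    show "AE x in lebesgue. norm ((f x)\<^sup>2) \<le> norm ((g x)\<^sup>2)"
    proof (rule AE_I2)
      show "norm ((f x)\<^sup>2) \<le> norm ((g x)\<^sup>2)" for x
        using power_mono[OF le[of x], of 2] by simp
    qed
  qed
qed (fact f)

lemma square_integrable_diff:
  assumes "square_integrable f" "square_integrable g"
  shows "square_integrable (\<lambda>x. f x - g x)"
  using square_integrable_add[OF assms(1) square_integrable_cmult[OF assms(2), of "-1"]] by simp

lemma L2_rel_refl_iff: "L2_rel f f \<longleftrightarrow> square_integrable f"
  by (simp add: L2_rel_def)

lemma abs_L2_eq_iff:
  assumes "square_integrable f" "square_integrable g"
  shows "abs_L2 f = abs_L2 g \<longleftrightarrow> (AE x in lebesgue. f x = g x)"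
  using Quotient_rel[OF Quotient_L2, of f g] assms by (simp add: L2_rel_def)

lemma rep_L2_square_integrable: "square_integrable (rep_L2 F)"
  using Quotient_rep_reflp[OF Quotient_L2, of F] by (simp add: L2_rel_refl_iff)

lemma abs_L2_rep_L2: "abs_L2 (rep_L2 F) = F"
  using Quotient_abs_rep[OF Quotient_L2] .

lemma norm_abs_L2:
  assumes "square_integrable f"
  shows "norm (abs_L2 f) = sqrt (\<integral>x. (f x)\<^sup>2 \<partial>lebesgue)"
  using assms by (simp add: norm_L2_def inner_L2.abs_eq L2_rel_refl_iff power2_eq_square)

lemma abs_L2_add:
  assumes "square_integrable f" "square_integrable g"
  shows "abs_L2 (\<lambda>x. f x + g x) = abs_L2 f + abs_L2 g"
  using assms by (simp add: plus_L2.abs_eq L2_rel_refl_iff)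

lemma abs_L2_diff:
  assumes "square_integrable f" "square_integrable g"
  shows "abs_L2 (\<lambda>x. f x - g x) = abs_L2 f - abs_L2 g"
  using assms by (simp add: minus_L2.abs_eq L2_rel_refl_iff)

lemma abs_L2_scaleR:
  assumes "square_integrable f"
  shows "abs_L2 (\<lambda>x. c * f x) = c *\<^sub>R abs_L2 f"
  using assms by (simp add: scaleR_L2.abs_eq L2_rel_refl_iff)

text \<open>This is the only source of convergence in \<open>L\<^sup>2\<close> below: the squared distance is the integral of
  \<open>(f n - l)\<^sup>2\<close>, which is dominated by \<open>(2 g)\<^sup>2\<close>.\<close>

lemma tendsto_abs_L2_dominated:
  assumes f: "\<And>n. square_integrable (f n)" and g: "square_integrable g"
    and le: "\<And>n x. \<bar>f n x\<bar> \<le> g x" and lim: "\<And>x. (\<lambda>n. f n x) \<longlonglongrightarrow> l x"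
  shows "square_integrable l" and "(\<lambda>n. abs_L2 (f n)) \<longlonglongrightarrow> abs_L2 l"
proof -
  have meas: "f n \<in> borel_measurable lebesgue" for n
    using f by (simp add: square_integrable_def)
  have lm: "l \<in> borel_measurable lebesgue"
    by (rule borel_measurable_LIMSEQ_real[OF lim meas])
  have lle: "\<bar>l x\<bar> \<le> g x" for x
    by (rule LIMSEQ_le_const2[OF tendsto_rabs[OF lim]]) (use le in auto)
  show l: "square_integrable l"
    by (rule square_integrable_dominated[OF g lm lle])
  have "(\<lambda>n. \<integral>x. (f n x - l x)\<^sup>2 \<partial>lebesgue) \<longlonglongrightarrow> (\<integral>x. 0 \<partial>(lebesgue :: real measure))"
  proof (rule integral_dominated_convergence)
    show "integrable lebesgue (\<lambda>x. (2 * g x)\<^sup>2)"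
      using square_integrable_cmult[OF g, of 2] by (simp add: square_integrable_def)
    show "AE x in lebesgue. (\<lambda>n. (f n x - l x)\<^sup>2) \<longlonglongrightarrow> 0"
    proof (rule AE_I2)
      fix x
      have "(\<lambda>n. (f n x - l x)\<^sup>2) \<longlonglongrightarrow> (l x - l x)\<^sup>2"
        by (intro tendsto_intros lim)
      then show "(\<lambda>n. (f n x - l x)\<^sup>2) \<longlonglongrightarrow> 0" by simp
    qed
    show "AE x in lebesgue. norm ((f n x - l x)\<^sup>2) \<le> (2 * g x)\<^sup>2" for n
    proof (rule AE_I2)
      fix x
      have "\<bar>f n x - l x\<bar> \<le> 2 * g x" using le[of n x] lle[of x] by linarith
      from power_mono[OF this, of 2] show "norm ((f n x - l x)\<^sup>2) \<le> (2 * g x)\<^sup>2" by simp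
    qed
  qed (use meas lm in auto)
  then have "(\<lambda>n. norm (abs_L2 (f n) - abs_L2 l)) \<longlonglongrightarrow> sqrt 0"
    using tendsto_real_sqrt f l
    by (fastforce simp: norm_abs_L2 square_integrable_diff simp flip: abs_L2_diff)
  then show "(\<lambda>n. abs_L2 (f n)) \<longlonglongrightarrow> abs_L2 l"
    by (simp add: tendsto_norm_zero_iff LIM_zero_iff)
qed

section \<open>The closed span of the translates of the Gaussian\<close>

definition gauss_translates :: "L2 set" where
  "gauss_translates = range (\<lambda>a. flow_Y a gaussian)"

definition approximable :: "(real \<Rightarrow> real) \<Rightarrow> bool" where
  "approximable f \<longleftrightarrow> square_integrable f \<and> abs_L2 f \<in> closure (span gauss_translates)"

lemma subspace_closure_span: "subspace (closure (span (S :: 'a::real_normed_vector set)))"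
proof (rule subspaceI)
  show "0 \<in> closure (span S)"
    by (rule subsetD[OF closure_subset span_zero])
  fix x y :: 'a and c :: real
  assume "x \<in> closure (span S)"
  then obtain u where u: "\<And>n. u n \<in> span S" "u \<longlonglongrightarrow> x"
    unfolding closure_sequential by blast
  have "(\<lambda>n. c *\<^sub>R u n) \<longlonglongrightarrow> c *\<^sub>R x" "\<And>n. c *\<^sub>R u n \<in> span S"
    using tendsto_scaleR[OF tendsto_const u(2)] span_scale[OF u(1)] by auto
  then show "c *\<^sub>R x \<in> closure (span S)"
    unfolding closure_sequential by (intro exI[of _ "\<lambda>n. c *\<^sub>R u n"]) auto
  assume "y \<in> closure (span S)"
  then obtain v where v: "\<And>n. v n \<in> span S" "v \<longlonglongrightarrow> y"
    unfolding closure_sequential by blast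
  have "(\<lambda>n. u n + v n) \<longlonglongrightarrow> x + y" "\<And>n. u n + v n \<in> span S"
    using tendsto_add[OF u(2) v(2)] span_add[OF u(1) v(1)] by auto
  then show "x + y \<in> closure (span S)"
    unfolding closure_sequential by (intro exI[of _ "\<lambda>n. u n + v n"]) auto
qed

lemma approximable_add:
  assumes "approximable f" "approximable g"
  shows "approximable (\<lambda>x. f x + g x)"
proof -
  have "square_integrable f" "square_integrable g"
    "abs_L2 f + abs_L2 g \<in> closure (span gauss_translates)"
    using assms subspace_add[OF subspace_closure_span, of "abs_L2 f" gauss_translates "abs_L2 g"]
    by (simp_all add: approximable_def)
  then show ?thesis by (simp add: approximable_def square_integrable_add abs_L2_add)
qed

lemma approximable_cmult:
  assumes "approximable f"
  shows "approximable (\<lambda>x. c * f x)"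
proof -
  have "square_integrable f" "c *\<^sub>R abs_L2 f \<in> closure (span gauss_translates)"
    using assms subspace_scale[OF subspace_closure_span, of "abs_L2 f" gauss_translates c]
    by (simp_all add: approximable_def)
  then show ?thesis by (simp add: approximable_def square_integrable_cmult abs_L2_scaleR)
qed

lemma approximable_cong_AE:
  assumes "approximable f" "square_integrable g" "AE x in lebesgue. f x = g x"
  shows "approximable g"
  using assms abs_L2_eq_iff[of f g] by (auto simp: approximable_def)

lemma approximable_dominated_limit:
  assumes f: "\<And>n. approximable (f n)" and g: "square_integrable g"
    and le: "\<And>n x. \<bar>f n x\<bar> \<le> g x" and lim: "\<And>x. (\<lambda>n. f n x) \<longlonglongrightarrow> l x"
  shows "approximable l"
proof -
  have sq: "square_integrable (f n)" for n using f by (simp add: approximable_def)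
  note tl = tendsto_abs_L2_dominated[OF sq g le lim]
  have "abs_L2 l \<in> closure (span gauss_translates)"
    by (rule closed_sequentially[OF closed_closure _ tl(2)])
      (use f in \<open>auto simp: approximable_def\<close>)
  with tl(1) show ?thesis by (simp add: approximable_def)
qed

text \<open>For \<open>c = 1 / 2\<close> the square is a multiple of a normal density with mean \<open>b\<close> and variance \<open>1 / 2\<close>;
  this function dominates those with larger \<open>c\<close>. The coefficient is kept in the form \<open>- c * x\<^sup>2\<close>,
  also for \<open>c = 1\<close>, so that all Gaussians below are instances of one pattern.\<close>

lemma square_integrable_exp_quadratic:
  assumes "1 / 2 \<le> c"
  shows "square_integrable (\<lambda>x. exp (- c * x\<^sup>2 + b * x))"
proof (rule square_integrable_dominated)
  have "integrable lborel (\<lambda>x. (sqrt pi * exp (b\<^sup>2)) * normal_density b (1 / sqrt 2) x)"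
    by (intro integrable_mult_right integrable_normal_density) simp
  also have "(\<lambda>x. (sqrt pi * exp (b\<^sup>2)) * normal_density b (1 / sqrt 2) x)
      = (\<lambda>x. (exp (- (1 / 2) * x\<^sup>2 + b * x))\<^sup>2)"
    by (auto simp: normal_density_def power2_eq_square real_sqrt_divide real_sqrt_mult
        algebra_simps simp flip: exp_add)
  finally have "integrable lborel (\<lambda>x. (exp (- (1 / 2) * x\<^sup>2 + b * x))\<^sup>2)" .
  then have "integrable lebesgue (\<lambda>x. (exp (- (1 / 2) * x\<^sup>2 + b * x))\<^sup>2)"
    by (subst integrable_completion) auto
  moreover have "(\<lambda>x. exp (- (1 / 2) * x\<^sup>2 + b * x)) \<in> borel_measurable lebesgue"
    by (intro measurable_completion) simp
  ultimately show "square_integrable (\<lambda>x. exp (- (1 / 2) * x\<^sup>2 + b * x))"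
    by (simp add: square_integrable_def)
  show "(\<lambda>x. exp (- c * x\<^sup>2 + b * x)) \<in> borel_measurable lebesgue"
    by (intro measurable_completion) simp
  show "\<bar>exp (- c * x\<^sup>2 + b * x)\<bar> \<le> exp (- (1 / 2) * x\<^sup>2 + b * x)" for x
    using mult_right_mono[OF assms, of "x\<^sup>2"] by simp
qed

lemma flow_Y_gaussian:
  "flow_Y a gaussian = exp (- a\<^sup>2) *\<^sub>R abs_L2 (\<lambda>x. exp (- 1 * x\<^sup>2 + (- 2 * a) * x))"
proof -
  have "flow_Y a gaussian = abs_L2 (\<lambda>x. exp (- (x + a)\<^sup>2))"
    using square_integrable_gaussian
    by (simp add: gaussian_def flow_Y.abs_eq L2_rel_refl_iff)
  also have "(\<lambda>x. exp (- (x + a)\<^sup>2)) = (\<lambda>x. exp (- a\<^sup>2) * exp (- 1 * x\<^sup>2 + (- 2 * a) * x))"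
    by (auto simp: power2_eq_square algebra_simps simp flip: exp_add)
  finally show ?thesis
    using square_integrable_exp_quadratic[of 1 "- 2 * a"] by (subst (asm) abs_L2_scaleR) auto
qed

lemma approximable_exp_gaussian: "approximable (\<lambda>x. exp (- 1 * x\<^sup>2 + b * x))"
proof -
  let ?E = "abs_L2 (\<lambda>x. exp (- 1 * x\<^sup>2 + b * x))"
  have "flow_Y (- b / 2) gaussian = exp (- (- b / 2)\<^sup>2) *\<^sub>R ?E"
    using flow_Y_gaussian[of "- b / 2"] by simp
  then have "?E = exp ((- b / 2)\<^sup>2) *\<^sub>R flow_Y (- b / 2) gaussian"
    by (simp only: scaleR_scaleR exp_add[symmetric]) simp
  moreover have "flow_Y (- b / 2) gaussian \<in> span gauss_translates"
    by (intro span_base) (auto simp: gauss_translates_def)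
  ultimately have "?E \<in> span gauss_translates" by (metis span_scale)
  then have "?E \<in> closure (span gauss_translates)" by (rule subsetD[OF closure_subset])
  then show ?thesis
    using square_integrable_exp_quadratic[of 1 b] by (simp add: approximable_def)
qed

section \<open>Narrower Gaussians\<close>

text \<open>Powers of \<open>cosh\<close> must grow more slowly than \<open>exp (x\<^sup>2)\<close>, so that the factor \<open>exp (- x\<^sup>2)\<close> absorbs
  them in the domination argument below. The bound holds because
  \<open>exp (- x\<^sup>2 / 2) * cosh x\<close> decreases on the nonnegative half-line.\<close>

lemma cosh_le_exp_half_square: "cosh (x :: real) \<le> exp (x\<^sup>2 / 2)"
proof -
  have nonneg: "cosh y \<le> exp (y\<^sup>2 / 2)" if "0 \<le> y" for y :: real
  proof -
    have sinh: "sinh z \<le> z * cosh z" if "0 \<le> z" for z :: real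
    proof -
      have "(\<lambda>z. z * cosh z - sinh z) 0 \<le> (\<lambda>z. z * cosh z - sinh z) z"
        by (rule DERIV_nonneg_imp_nondecreasing[OF that])
          (auto intro!: exI derivative_eq_intros)
      then show ?thesis by simp
    qed
    have "(\<lambda>z. exp (- (z\<^sup>2 / 2)) * cosh z) y \<le> (\<lambda>z. exp (- (z\<^sup>2 / 2)) * cosh z) 0"
    proof (rule DERIV_nonpos_imp_nonincreasing[OF that])
      fix z :: real assume "0 \<le> z" "z \<le> y"
      have "((\<lambda>z. exp (- (z\<^sup>2 / 2)) * cosh z) has_real_derivative
          exp (- (z\<^sup>2 / 2)) * (sinh z - z * cosh z)) (at z)"
        by (auto intro!: derivative_eq_intros simp: algebra_simps)
      moreover have "exp (- (z\<^sup>2 / 2)) * (sinh z - z * cosh z) \<le> 0"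
        using sinh[OF \<open>0 \<le> z\<close>] by (simp add: mult_nonneg_nonpos)
      ultimately show "\<exists>d. ((\<lambda>z. exp (- (z\<^sup>2 / 2)) * cosh z) has_real_derivative d) (at z) \<and> d \<le> 0"
        by blast
    qed
    then show ?thesis by (simp add: exp_minus field_simps)
  qed
  show ?thesis using nonneg[of "\<bar>x\<bar>"] by simp
qed

text \<open>Multiplication by \<open>cosh (d x)\<close> averages the shifts \<open>b + d\<close> and \<open>b - d\<close> of the linear coefficient, so
  polynomials in \<open>cosh (d x)\<close> times \<open>exp (- x\<^sup>2 + b x)\<close> stay in the span.\<close>

lemma approximable_cosh_power:
  "approximable (\<lambda>x. exp (- 1 * x\<^sup>2 + b * x) * (2 - cosh (d * x)) ^ n)"
proof (induction n arbitrary: b)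
  case 0
  then show ?case using approximable_exp_gaussian by simp
next
  case (Suc n)
  let ?p = "\<lambda>b x. exp (- 1 * x\<^sup>2 + b * x) * (2 - cosh (d * x)) ^ n"
  have "approximable (\<lambda>x. 2 * ?p b x + ((- 1 / 2) * ?p (b + d) x + (- 1 / 2) * ?p (b - d) x))"
    by (intro approximable_add approximable_cmult Suc.IH)
  also have "(\<lambda>x. 2 * ?p b x + ((- 1 / 2) * ?p (b + d) x + (- 1 / 2) * ?p (b - d) x)) =
      (\<lambda>x. exp (- 1 * x\<^sup>2 + b * x) * (2 - cosh (d * x)) ^ Suc n)"
  proof
    fix x
    have "exp (- 1 * x\<^sup>2 + (b + d) * x) = exp (- 1 * x\<^sup>2 + b * x) * exp (d * x)"
      "exp (- 1 * x\<^sup>2 + (b - d) * x) = exp (- 1 * x\<^sup>2 + b * x) * exp (- (d * x))"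
      by (simp_all add: algebra_simps flip: exp_add)
    then show "2 * ?p b x + ((- 1 / 2) * ?p (b + d) x + (- 1 / 2) * ?p (b - d) x) =
      exp (- 1 * x\<^sup>2 + b * x) * (2 - cosh (d * x)) ^ Suc n"
      by (simp add: cosh_def algebra_simps)
  qed
  finally show ?case .
qed

text \<open>Here \<open>2 - cosh y\<close> is chosen as a combination of real exponentials that behaves like
  \<open>1 - y\<^sup>2 / 2\<close> near \<open>0\<close>, so that its powers converge to a decaying Gaussian.\<close>

lemma tendsto_two_minus_cosh_power:
  "(\<lambda>n. (2 - cosh (1 / sqrt (real n) * x)) ^ n) \<longlonglongrightarrow> exp (- (x\<^sup>2 / 2))"
proof -
  have pos: "(\<lambda>n. (2 - cosh (1 / sqrt (real n) * y)) ^ n) \<longlonglongrightarrow> exp (- (y\<^sup>2 / 2))"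
    if "y > 0" for y :: real
    using that unfolding cosh_field_def power2_eq_square by real_asymp
  show ?thesis
  proof (cases "x = 0")
    case False
    have even: "cosh (1 / sqrt (real n) * \<bar>x\<bar>) = cosh (1 / sqrt (real n) * x)" for n
      by (cases "x \<ge> 0") auto
    then show ?thesis using pos[of "\<bar>x\<bar>"] False unfolding even power2_abs by simp
  qed simp
qed

text \<open>Passing to a narrower Gaussian is the decisive step: widening could be done by averaging
  translates, but narrowing amounts to a deconvolution. It succeeds because the factors
  \<open>(2 - cosh (x / sqrt n)) ^ n\<close> grow at most like \<open>exp (x\<^sup>2 / 2)\<close>, uniformly in \<open>n\<close>.\<close>

lemma approximable_narrow_gaussian: "approximable (\<lambda>x. exp (- (3 / 2) * x\<^sup>2 + b * x))"
proof (rule approximable_dominated_limit)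
  let ?f = "\<lambda>n x. exp (- 1 * x\<^sup>2 + b * x) * (2 - cosh (1 / sqrt (real n) * x)) ^ n"
  show "approximable (?f n)" for n
    by (rule approximable_cosh_power)
  show "square_integrable (\<lambda>x. exp (- (1 / 2) * x\<^sup>2 + b * x))"
    by (rule square_integrable_exp_quadratic) simp
  show "\<bar>?f n x\<bar> \<le> exp (- (1 / 2) * x\<^sup>2 + b * x)" for n x
  proof -
    define y where "y = 1 / sqrt (real n) * x"
    have "\<bar>2 - cosh y\<bar> \<le> cosh y" using cosh_real_ge_1[of y] by linarith
    also have "\<dots> \<le> exp (y\<^sup>2 / 2)" by (rule cosh_le_exp_half_square)
    finally have "\<bar>2 - cosh y\<bar> ^ n \<le> exp (y\<^sup>2 / 2) ^ n" by (rule power_mono) simp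
    also have "\<dots> = exp (real n * (y\<^sup>2 / 2))" by (rule exp_of_nat_mult[symmetric])
    also have "\<dots> \<le> exp (x\<^sup>2 / 2)" by (cases "n = 0") (auto simp: y_def power_divide)
    finally have "\<bar>?f n x\<bar> \<le> exp (- 1 * x\<^sup>2 + b * x) * exp (x\<^sup>2 / 2)"
      by (simp add: abs_mult power_abs y_def)
    also have "\<dots> = exp (- (1 / 2) * x\<^sup>2 + b * x)"
      by (simp add: algebra_simps flip: exp_add)
    finally show ?thesis .
  qed
  show "(\<lambda>n. ?f n x) \<longlonglongrightarrow> exp (- (3 / 2) * x\<^sup>2 + b * x)" for x
  proof -
    have "(\<lambda>n. ?f n x) \<longlonglongrightarrow> exp (- 1 * x\<^sup>2 + b * x) * exp (- (x\<^sup>2 / 2))"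
      by (intro tendsto_mult tendsto_const tendsto_two_minus_cosh_power)
    also have "exp (- 1 * x\<^sup>2 + b * x) * exp (- (x\<^sup>2 / 2)) = exp (- (3 / 2) * x\<^sup>2 + b * x)"
      by (simp add: algebra_simps flip: exp_add)
    finally show ?thesis .
  qed
qed

section \<open>Bounded functions that preserve the closed span\<close>

definition multiplier :: "(real \<Rightarrow> real) \<Rightarrow> bool" where
  "multiplier u \<longleftrightarrow> (\<exists>B. \<forall>x. \<bar>u x\<bar> \<le> B) \<and>
     (\<forall>f. approximable f \<longrightarrow> approximable (\<lambda>x. u x * f x))"

lemma multiplier_const: "multiplier (\<lambda>x. c)"
  unfolding multiplier_def by (auto simp: approximable_cmult)

lemma multiplier_mult:
  assumes "multiplier u" "multiplier v"
  shows "multiplier (\<lambda>x. u x * v x)"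
proof -
  obtain B C where "\<And>x. \<bar>u x\<bar> \<le> B" "\<And>x. \<bar>v x\<bar> \<le> C"
    using assms unfolding multiplier_def by auto
  then have "\<bar>u x * v x\<bar> \<le> B * C" for x
    unfolding abs_mult by (meson abs_ge_zero mult_mono order_trans)
  then show ?thesis using assms unfolding multiplier_def mult.assoc by blast
qed

lemma multiplier_add:
  assumes "multiplier u" "multiplier v"
  shows "multiplier (\<lambda>x. u x + v x)"
proof -
  obtain B C where "\<And>x. \<bar>u x\<bar> \<le> B" "\<And>x. \<bar>v x\<bar> \<le> C"
    using assms unfolding multiplier_def by auto
  then have "\<bar>u x + v x\<bar> \<le> B + C" for x
    by (meson abs_triangle_ineq add_mono order_trans)
  then show ?thesis using assms approximable_add unfolding multiplier_def distrib_right by blast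
qed

lemma multiplier_diff:
  assumes "multiplier u" "multiplier v"
  shows "multiplier (\<lambda>x. u x - v x)"
  using multiplier_add[OF assms(1) multiplier_mult[OF multiplier_const[of "-1"] assms(2)]] by simp

lemma multiplier_power: "multiplier u \<Longrightarrow> multiplier (\<lambda>x. u x ^ n)"
  by (induction n) (auto intro: multiplier_mult multiplier_const)

lemma multiplier_sum:
  assumes "finite I" "\<And>i. i \<in> I \<Longrightarrow> multiplier (u i)"
  shows "multiplier (\<lambda>x. \<Sum>i\<in>I. u i x)"
  using assms by (induction I) (auto intro: multiplier_add multiplier_const)

lemma multiplier_bounded_limit:
  assumes u: "\<And>n. multiplier (u n)" and le: "\<And>n x. \<bar>u n x\<bar> \<le> B"
    and lim: "\<And>x. (\<lambda>n. u n x) \<longlonglongrightarrow> l x"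
  shows "multiplier l"
  unfolding multiplier_def
proof (intro conjI allI impI exI)
  show "\<bar>l x\<bar> \<le> B" for x
    by (rule LIMSEQ_le_const2[OF tendsto_rabs[OF lim]]) (use le in auto)
  fix f assume f: "approximable f"
  have g: "square_integrable (\<lambda>x. B * \<bar>f x\<bar>)"
    using f by (intro square_integrable_cmult) (auto simp: approximable_def square_integrable_def)
  show "approximable (\<lambda>x. l x * f x)"
  proof (rule approximable_dominated_limit[OF _ g])
    show "approximable (\<lambda>x. u n x * f x)" for n
      using u f unfolding multiplier_def by blast
    show "\<bar>u n x * f x\<bar> \<le> B * \<bar>f x\<bar>" for n x
      unfolding abs_mult by (intro mult_right_mono le) simp
    show "(\<lambda>n. u n x * f x) \<longlonglongrightarrow> l x * f x" for x
      by (intro tendsto_mult lim tendsto_const)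
  qed
qed

text \<open>Multiplication by a bounded function is a bounded linear operator on \<open>L\<^sup>2\<close>, hence it maps a closed
  span into itself as soon as it does so with the generators.\<close>

lemma multiplier_if_generators:
  assumes u: "u \<in> borel_measurable lebesgue" and B: "\<And>x. \<bar>u x\<bar> \<le> B"
    and gen: "\<And>b. approximable (\<lambda>x. u x * exp (- 1 * x\<^sup>2 + b * x))"
  shows "multiplier u"
proof -
  let ?V = "closure (span gauss_translates)"
  have sq: "square_integrable (\<lambda>x. u x * f x)" if "square_integrable f" for f
  proof (rule square_integrable_dominated)
    show "square_integrable (\<lambda>x. B * \<bar>f x\<bar>)"
      using that by (intro square_integrable_cmult) (auto simp: square_integrable_def)
    show "(\<lambda>x. u x * f x) \<in> borel_measurable lebesgue"
      using u that by (auto simp: square_integrable_def)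
    show "\<bar>u x * f x\<bar> \<le> B * \<bar>f x\<bar>" for x
      unfolding abs_mult by (intro mult_right_mono B) simp
  qed
  (* The operator is defined through chosen representatives; the choice is immaterial by T_abs. *)
  define T where "T F = abs_L2 (\<lambda>x. u x * rep_L2 F x)" for F
  have T_abs: "T (abs_L2 f) = abs_L2 (\<lambda>x. u x * f x)" if f: "square_integrable f" for f
  proof -
    have "AE x in lebesgue. rep_L2 (abs_L2 f) x = f x"
      using abs_L2_eq_iff[OF rep_L2_square_integrable f] abs_L2_rep_L2 by blast
    then have "AE x in lebesgue. u x * rep_L2 (abs_L2 f) x = u x * f x" by auto
    then show ?thesis
      unfolding T_def using abs_L2_eq_iff[OF sq sq] rep_L2_square_integrable f by blast
  qed
  have ex: "\<exists>f. square_integrable f \<and> F = abs_L2 f" for F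
    using rep_L2_square_integrable abs_L2_rep_L2 by metis
  have lin: "bounded_linear T"
  proof (rule bounded_linear_intro)
    fix F G :: L2 and r :: real
    obtain f g where f: "square_integrable f" "F = abs_L2 f" and g: "square_integrable g" "G = abs_L2 g"
      using ex by metis
    have "T (F + G) = abs_L2 (\<lambda>x. u x * (f x + g x))"
      using T_abs[OF square_integrable_add[OF f(1) g(1)]] f g by (simp add: abs_L2_add)
    also have "\<dots> = T F + T G"
      using f g by (simp add: T_abs distrib_left abs_L2_add sq)
    finally show "T (F + G) = T F + T G" .
    have "T (r *\<^sub>R F) = abs_L2 (\<lambda>x. r * (u x * f x))"
      using T_abs[OF square_integrable_cmult[OF f(1)]] f by (simp add: abs_L2_scaleR mult.left_commute)
    then show "T (r *\<^sub>R F) = r *\<^sub>R T F"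
      using f by (simp add: T_abs abs_L2_scaleR sq)
    have "(\<integral>x. (u x * f x)\<^sup>2 \<partial>lebesgue) \<le> (\<integral>x. B\<^sup>2 * (f x)\<^sup>2 \<partial>lebesgue)"
    proof (rule integral_mono)
      show "integrable lebesgue (\<lambda>x. (u x * f x)\<^sup>2)"
        using sq[OF f(1)] by (simp add: square_integrable_def)
      show "integrable lebesgue (\<lambda>x. B\<^sup>2 * (f x)\<^sup>2)"
        using f(1) by (simp add: square_integrable_def)
      show "(u x * f x)\<^sup>2 \<le> B\<^sup>2 * (f x)\<^sup>2" for x
        using power_mono[OF B[of x], of 2] by (simp add: power_mult_distrib mult_right_mono)
    qed
    then have "sqrt (\<integral>x. (u x * f x)\<^sup>2 \<partial>lebesgue) \<le> sqrt (B\<^sup>2 * (\<integral>x. (f x)\<^sup>2 \<partial>lebesgue))"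
      by simp
    also have "\<dots> = sqrt (\<integral>x. (f x)\<^sup>2 \<partial>lebesgue) * \<bar>B\<bar>"
      by (simp add: real_sqrt_mult)
    finally show "norm (T F) \<le> norm F * \<bar>B\<bar>"
      using f by (simp add: T_abs norm_abs_L2 sq)
  qed
  have "T ` gauss_translates \<subseteq> ?V"
  proof
    fix G assume "G \<in> T ` gauss_translates"
    then obtain a where "G = T (flow_Y a gaussian)" by (auto simp: gauss_translates_def)
    then have "G = exp (- a\<^sup>2) *\<^sub>R abs_L2 (\<lambda>x. u x * exp (- 1 * x\<^sup>2 + (- 2 * a) * x))"
      using linear_scale[OF bounded_linear.linear[OF lin]]
        T_abs[OF square_integrable_exp_quadratic[of 1 "- 2 * a"]]
      by (simp add: flow_Y_gaussian)
    then show "G \<in> ?V"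
      using gen[of "- 2 * a"]
      by (auto simp: approximable_def intro: subspace_scale[OF subspace_closure_span])
  qed
  then have "T ` span gauss_translates \<subseteq> ?V"
    using span_minimal[OF _ subspace_closure_span]
    by (simp flip: linear_span_image[OF bounded_linear.linear[OF lin]])
  then have TV: "T ` ?V \<subseteq> ?V"
    using closure_bounded_linear_image_subset[OF lin, of "span gauss_translates"]
      closure_minimal[OF _ closed_closure] by blast
  have "approximable (\<lambda>x. u x * f x)" if "approximable f" for f
    using that TV T_abs[of f] sq[of f] by (auto simp: approximable_def)
  with B show ?thesis unfolding multiplier_def by blast
qed

text \<open>The product of \<open>exp (- (x - m)\<^sup>2 / 2)\<close> with a generator \<open>exp (- x\<^sup>2 + b x)\<close> is a multiple of
  \<open>exp (- 3/2 x\<^sup>2 + (b + m) x)\<close>, a narrow Gaussian.\<close>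

lemma multiplier_gaussian: "multiplier (\<lambda>x. exp (- ((x - m)\<^sup>2 / 2)))"
proof (rule multiplier_if_generators)
  show "(\<lambda>x. exp (- ((x - m)\<^sup>2 / 2))) \<in> borel_measurable lebesgue"
    by (intro measurable_completion) simp
  show "\<bar>exp (- ((x - m)\<^sup>2 / 2))\<bar> \<le> 1" for x by simp
  fix b
  have "approximable (\<lambda>x. exp (- (m\<^sup>2 / 2)) * exp (- (3 / 2) * x\<^sup>2 + (b + m) * x))"
    by (intro approximable_cmult approximable_narrow_gaussian)
  also have "(\<lambda>x. exp (- (m\<^sup>2 / 2)) * exp (- (3 / 2) * x\<^sup>2 + (b + m) * x)) =
      (\<lambda>x. exp (- ((x - m)\<^sup>2 / 2)) * exp (- 1 * x\<^sup>2 + b * x))"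
    by (auto simp: power2_eq_square field_simps simp flip: exp_add)
  finally show "approximable (\<lambda>x. exp (- ((x - m)\<^sup>2 / 2)) * exp (- 1 * x\<^sup>2 + b * x))" .
qed

section \<open>Indicators as multipliers\<close>

text \<open>The polynomials \<open>(1 - u / k) ^ k\<close> in \<open>u\<close> converge to \<open>exp (- u)\<close>, and they are bounded by \<open>1\<close> once
  \<open>k\<close> exceeds an upper bound of \<open>u\<close>; this is why the sequence starts at \<open>Suc N\<close>.\<close>

lemma multiplier_exp_minus:
  assumes u: "multiplier u" and nonneg: "\<And>x. 0 \<le> u x"
  shows "multiplier (\<lambda>x. exp (- u x))"
proof -
  obtain B where B: "\<And>x. \<bar>u x\<bar> \<le> B" using u unfolding multiplier_def by blast
  obtain N :: nat where N: "B \<le> real N" using real_arch_simple by blast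
  show ?thesis
  proof (rule multiplier_bounded_limit)
    let ?v = "\<lambda>n x. (1 - 1 / real (n + Suc N) * u x) ^ (n + Suc N)"
    show "multiplier (?v n)" for n
      by (intro multiplier_power multiplier_diff multiplier_mult multiplier_const u)
    show "\<bar>?v n x\<bar> \<le> 1" for n x
    proof -
      have "u x \<le> real (n + Suc N)" using B[of x] N by simp
      then have "1 / real (n + Suc N) * u x \<le> 1" by simp
      moreover have "0 \<le> 1 / real (n + Suc N) * u x" using nonneg[of x] by simp
      ultimately have "\<bar>1 - 1 / real (n + Suc N) * u x\<bar> \<le> 1" by linarith
      then show ?thesis unfolding power_abs by (intro power_le_one) auto
    qed
    show "(\<lambda>n. ?v n x) \<longlonglongrightarrow> exp (- u x)" for x
      using LIMSEQ_ignore_initial_segment[OF tendsto_exp_limit_sequentially[of "- u x"], of "Suc N"]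
      by simp
  qed
qed

text \<open>The functions \<open>exp (- k (u / t) ^ k)\<close> tend to \<open>1\<close> where \<open>u < t\<close> and to \<open>0\<close> where \<open>u > t\<close>. The factor
  \<open>k\<close> in front of the power forces the limit \<open>0\<close> also where \<open>u = t\<close>.\<close>

lemma multiplier_indicator_less:
  assumes u: "multiplier u" and nonneg: "\<And>x. 0 \<le> u x" and t: "0 < t"
  shows "multiplier (indicator {x. u x < t})"
proof (rule multiplier_bounded_limit)
  let ?v = "\<lambda>k x. exp (- (real k * (1 / t * u x) ^ k))"
  show "multiplier (?v k)" for k
    using nonneg t
    by (intro multiplier_exp_minus multiplier_mult multiplier_power multiplier_const u) simp
  show "\<bar>?v k x\<bar> \<le> 1" for k x
    using nonneg[of x] t by simp
  show "(\<lambda>k. ?v k x) \<longlonglongrightarrow> indicator {x. u x < t} x" for x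
  proof (cases "u x < t")
    case True
    then have "norm (1 / t * u x) < 1" using nonneg[of x] t by simp
    from tendsto_exp[OF tendsto_minus[OF powser_times_n_limit_0[OF this]]] True
    show ?thesis by simp
  next
    case False
    then have "1 \<le> 1 / t * u x" using t by simp
    then have "real k * 1 \<le> real k * (1 / t * u x) ^ k" for k
      by (intro mult_left_mono one_le_power) auto
    then have "?v k x \<le> exp (- real k)" for k by simp
    moreover have "(\<lambda>k. exp (- real k)) \<longlonglongrightarrow> 0" by real_asymp
    ultimately have "(\<lambda>k. ?v k x) \<longlonglongrightarrow> 0"
      by (intro tendsto_sandwich[of "\<lambda>_. 0" "\<lambda>k. ?v k x" sequentially "\<lambda>k. exp (- real k)" 0]) auto
    with False show ?thesis by simp
  qed
qed

lemma multiplier_indicator_compl: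
  assumes "multiplier (indicator S)"
  shows "multiplier (indicator (- S))"
proof -
  have "(indicator (- S) :: real \<Rightarrow> real) = (\<lambda>x. 1 - indicator S x)"
    by (auto simp: indicator_def)
  then show ?thesis using multiplier_diff[OF multiplier_const assms] by metis
qed

text \<open>A compact interval with midpoint \<open>m\<close> and radius \<open>r\<close> is the complement of
  \<open>{x. exp (- (x - m)\<^sup>2 / 2) < exp (- r\<^sup>2 / 2)}\<close>, also when \<open>r = 0\<close>. Compact intervals are stable under
  intersection and generate the Borel sets, so it suffices to pass to complements and to countable
  disjoint unions, which are bounded limits of finite sums.\<close>

lemma multiplier_indicator_borel:
  assumes "S \<in> sets borel"
  shows "multiplier (indicator S)"
  using assms
proof (induction rule: borel_set_induct)
  case empty
  then show ?case using multiplier_const[of 0] by simp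
next
  case (interval a b)
  show ?case
  proof -
    let ?m = "(a + b) / 2" and ?r = "(b - a) / 2"
    have outside: "{x. exp (- ((x - ?m)\<^sup>2 / 2)) < exp (- (?r\<^sup>2 / 2))} = - {a..b}"
    proof -
      have e1: "exp (- ((x - ?m)\<^sup>2 / 2)) < exp (- (?r\<^sup>2 / 2)) \<longleftrightarrow> \<bar>?r\<bar> < \<bar>x - ?m\<bar>" for x
        using abs_le_square_iff[of "x - ?m" ?r] by auto
      have e2: "\<bar>?r\<bar> < \<bar>x - ?m\<bar> \<longleftrightarrow> \<not> (a \<le> x \<and> x \<le> b)" for x
        using interval by (auto simp: abs_if field_simps)
      show ?thesis unfolding e1 e2 by auto
    qed
    have "multiplier (indicator {x. exp (- ((x - ?m)\<^sup>2 / 2)) < exp (- (?r\<^sup>2 / 2))})"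
      by (rule multiplier_indicator_less[OF multiplier_gaussian]) simp_all
    then have "multiplier (indicator (- {a..b}))" unfolding outside .
    from multiplier_indicator_compl[OF this] show ?thesis by (simp only: double_complement)
  qed
next
  case (compl A)
  then show ?case by (intro multiplier_indicator_compl)
next
  case (union A)
  show ?case
  proof (rule multiplier_bounded_limit)
    show "multiplier (\<lambda>x. \<Sum>i<n. indicator (A i) x)" for n
      by (intro multiplier_sum union) simp
    have eq: "(\<Sum>i<n. indicator (A i) x) = (indicator (\<Union>i<n. A i) x :: real)" for n x
      using union(1) by (intro indicator_UN_disjoint[symmetric]) (auto simp: disjoint_family_on_def)
    show "\<bar>\<Sum>i<n. indicator (A i) x\<bar> \<le> (1 :: real)" for n x
      unfolding eq by (simp add: indicator_le_1)
    show "(\<lambda>n. \<Sum>i<n. indicator (A i) x) \<longlonglongrightarrow> (indicator (\<Union>i. A i) x :: real)" for x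
      unfolding eq by (rule LIMSEQ_indicator_UN)
  qed
qed

lemma multiplier_simple_function:
  assumes "simple_function lborel s"
  shows "multiplier s"
proof -
  have fin: "finite (range s)" using assms by (simp add: simple_function_def)
  have "s -` {y} \<in> sets borel" for y
    using simple_functionD(2)[OF assms, of "{y}"] by simp
  then have "multiplier (\<lambda>x. \<Sum>y\<in>range s. y * indicator (s -` {y}) x)"
    by (intro multiplier_sum fin multiplier_mult multiplier_const multiplier_indicator_borel)
  also have "(\<lambda>x. \<Sum>y\<in>range s. y * indicator (s -` {y}) x) = s"
  proof
    fix x
    have "(\<Sum>y\<in>range s. y * indicator (s -` {y}) x) = (\<Sum>y\<in>{s x}. y * indicator (s -` {y}) x)"
      by (rule sum.mono_neutral_right[OF fin]) (auto simp: indicator_def)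
    then show "(\<Sum>y\<in>range s. y * indicator (s -` {y}) x) = s x" by simp
  qed
  finally show ?thesis .
qed

section \<open>Density of the reachable set\<close>

lemma approximable_if_square_integrable:
  assumes f: "square_integrable f"
  shows "approximable f"
proof -
  obtain g where g[measurable]: "g \<in> borel_measurable lborel" and ae: "AE x in lborel. f x = g x"
    using completion_ex_borel_measurable_real[of f lborel] f by (auto simp: square_integrable_def)
  have ae': "AE x in lebesgue. f x = g x" using ae by (rule AE_completion)
  have gm: "g \<in> borel_measurable lebesgue" using g by (rule measurable_completion)
  have sq: "square_integrable g"
    unfolding square_integrable_def
  proof
    show "integrable lebesgue (\<lambda>x. (g x)\<^sup>2)"
    proof (rule integrable_cong_AE_imp)
      show "integrable lebesgue (\<lambda>x. (f x)\<^sup>2)"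
        using f by (simp add: square_integrable_def)
      show "(\<lambda>x. (g x)\<^sup>2) \<in> borel_measurable lebesgue"
        using gm by (rule borel_measurable_power)
      show "AE x in lebesgue. (f x)\<^sup>2 = (g x)\<^sup>2"
        using ae' by eventually_elim simp
    qed
  qed (fact gm)
  (* The quotient of g by the Gaussian need not be bounded or integrable; only the products of the
     approximating simple functions with the Gaussian have to be dominated. *)
  have "(\<lambda>x. g x * exp (x\<^sup>2)) \<in> borel_measurable lborel" by measurable
  from borel_measurable_implies_sequence_metric[OF this, of 0]
  obtain s where s: "\<forall>i. simple_function lborel (s i)"
    and lim: "\<forall>x\<in>space lborel. (\<lambda>i. s i x) \<longlonglongrightarrow> g x * exp (x\<^sup>2)"
    and le: "\<forall>i. \<forall>x\<in>space lborel. dist (s i x) 0 \<le> 2 * dist (g x * exp (x\<^sup>2)) 0"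
    by (elim exE conjE)
  have "approximable g"
  proof (rule approximable_dominated_limit)
    let ?e = "\<lambda>x. exp (- 1 * x\<^sup>2 + 0 * x)"
    show "approximable (\<lambda>x. s i x * ?e x)" for i
      using multiplier_simple_function[OF s[rule_format, of i]] approximable_exp_gaussian[of 0]
      unfolding multiplier_def by blast
    show "square_integrable (\<lambda>x. 2 * \<bar>g x\<bar>)"
      using sq by (intro square_integrable_cmult) (auto simp: square_integrable_def)
    have e: "exp (x\<^sup>2) * ?e x = 1" for x :: real by (simp flip: exp_add)
    show "\<bar>s i x * ?e x\<bar> \<le> 2 * \<bar>g x\<bar>" for i x
    proof -
      have "\<bar>s i x\<bar> \<le> 2 * \<bar>g x\<bar> * exp (x\<^sup>2)"
        using le by (simp add: abs_mult mult.assoc)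
      from mult_right_mono[OF this, of "?e x"] show ?thesis
        unfolding mult.assoc e by (simp add: abs_mult)
    qed
    show "(\<lambda>i. s i x * ?e x) \<longlonglongrightarrow> g x" for x
    proof -
      have "(\<lambda>i. s i x * ?e x) \<longlonglongrightarrow> g x * exp (x\<^sup>2) * ?e x"
        using lim by (intro tendsto_mult tendsto_const) simp
      then show ?thesis unfolding mult.assoc e by simp
    qed
  qed
  then show ?thesis
    by (rule approximable_cong_AE[OF _ f]) (use ae' in eventually_elim, simp)
qed

lemma closure_span_gauss_translates: "closure (span gauss_translates) = UNIV"
proof -
  have "F \<in> closure (span gauss_translates)" for F
    using approximable_if_square_integrable[OF rep_L2_square_integrable[of F]]
    by (simp add: approximable_def abs_L2_rep_L2)
  then show ?thesis by blast
qed

lemma reachable_set_zero: "0 \<in> reachable_set X Y"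
  unfolding reachable_set_def by (rule CollectI, rule exI, rule exI, rule exI[of _ 0]) simp

lemma reachable_set_step:
  assumes "f \<in> reachable_set X Y"
  shows "Y a (X c f) \<in> reachable_set X Y"
proof -
  obtain s t n where f: "f = fold (\<lambda>i. Y (s i) \<circ> X (t i)) [1..<Suc n] 0"
    using assms unfolding reachable_set_def by blast
  let ?s = "s(Suc n := a)" and ?t = "t(Suc n := c)"
  have "fold (\<lambda>i. Y (?s i) \<circ> X (?t i)) [1..<Suc n] 0 = f"
    unfolding f by (intro fold_cong) auto
  then have "Y a (X c f) = fold (\<lambda>i. Y (?s i) \<circ> X (?t i)) [1..<Suc (Suc n)] 0"
    by simp
  then show ?thesis unfolding reachable_set_def by blast
qed

lemma flow_Y_add: "flow_Y a (f + g) = flow_Y a f + flow_Y a g"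
  by transfer (auto simp: L2_rel_def intro!: square_integrable_add square_integrable_translate)

lemma flow_Y_scaleR: "flow_Y a (c *\<^sub>R f) = c *\<^sub>R flow_Y a f"
  by transfer (auto simp: L2_rel_def intro!: square_integrable_cmult square_integrable_translate)

lemma flow_Y_minus_cancel: "flow_Y a (flow_Y (- a) f) = f"
  by transfer (auto simp: L2_rel_def)

text \<open>Shifting back, adding \<open>c\<close> times the Gaussian and shifting forth adds \<open>c\<close> times a translate. The
  first shift is preceded by the trivial step \<open>flow_X 0\<close> since the two kinds of flow must
  alternate.\<close>

lemma span_gauss_translates_subset_reachable: "span gauss_translates \<subseteq> reachable_set flow_X flow_Y"
proof
  fix f assume "f \<in> span gauss_translates"
  then show "f \<in> reachable_set flow_X flow_Y"
  proof (induction rule: span_induct_alt)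
    case base
    show ?case by (rule reachable_set_zero)
  next
    case (step c x y)
    then obtain a where x: "x = flow_Y a gaussian" by (auto simp: gauss_translates_def)
    have "flow_Y a (flow_X c (flow_Y (- a) (flow_X 0 y))) \<in> reachable_set flow_X flow_Y"
      by (intro reachable_set_step step)
    also have "flow_Y a (flow_X c (flow_Y (- a) (flow_X 0 y))) = c *\<^sub>R x + y"
      by (simp add: x flow_X_def flow_Y_add flow_Y_scaleR flow_Y_minus_cancel)
    finally show ?case .
  qed
qed

theorem theorem48:
  shows "closure (reachable_set flow_X flow_Y) = UNIV"
  using closure_mono[OF span_gauss_translates_subset_reachable] closure_span_gauss_translates
  by blast

end
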